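(* Let $K$ be an almost real closed field endowed with an order $<$, and let $v_K$ be its canonical henselian valuation. Then there exists a compatible angular component map $\mathrm{ac}\colon K\to Kv_K$.
   Context: A field $K$ is almost real closed if it admits a (possibly trivial) henselian valuation whose residue field is real closed. An order on $K$ means a linear order making $K$ an ordered field. The canonical henselian valuation $v_K$ on an almost real closed field $K$ is the finest henselian valuation on $K$; it is at the same time the finest convex valuation with respect to any order on $K$, and its residue field $Kv_K$ is real closed. For a henselian (hence convex) valuation $v$ on an ordered field $(K,<)$ with valuation ring $\mathcal{O}_v$, the residue field $Kv$ carries the induced order, for which the residue $\overline{a}$ of a unit $a\in\mathcal{O}_v^\times$ is positive iff $a>0$. An angular component map is a map $\mathrm{ac}\colon K\to Kv$ with $\mathrm{ac}(0)=0$ which restricts to a group homomorphism $K^\times\to(Kv)^\times$ and satisfies $\mathrm{ac}(u)=\overline{u}$ for all $u\in\mathcal{O}_v^\times$. It is compatible (with $<$) if for all $x\in K$: $x>0$ if and only if $\mathrm{ac}(x)>0$. *)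

theory Defs
  imports "HOL-Algebra.Algebra"
begin

section \<open>Ordered fields and real closed fields\<close>

text \<open>An order is given by its reflexive relation \<open>r = {(a, b). a \<le> b}\<close> on the carrier.\<close>

definition pos :: "('a, 'b) ring_scheme \<Rightarrow> 'a rel \<Rightarrow> 'a \<Rightarrow> bool" where
  "pos K r x \<longleftrightarrow> (\<zero>\<^bsub>K\<^esub>, x) \<in> r \<and> x \<noteq> \<zero>\<^bsub>K\<^esub>"

definition ordered_field :: "('a, 'b) ring_scheme \<Rightarrow> 'a rel \<Rightarrow> bool" where
  "ordered_field K r \<longleftrightarrow>
     field K \<and> linear_order_on (carrier K) r \<and>
     (\<forall>a b. \<forall>c\<in>carrier K. (a, b) \<in> r \<longrightarrow> (a \<oplus>\<^bsub>K\<^esub> c, b \<oplus>\<^bsub>K\<^esub> c) \<in> r) \<and>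
     (\<forall>a b. (\<zero>\<^bsub>K\<^esub>, a) \<in> r \<and> (\<zero>\<^bsub>K\<^esub>, b) \<in> r \<longrightarrow> (\<zero>\<^bsub>K\<^esub>, a \<otimes>\<^bsub>K\<^esub> b) \<in> r)"

definition real_closed :: "('a, 'b) ring_scheme \<Rightarrow> bool" where
  "real_closed F \<longleftrightarrow>
     (\<exists>r. ordered_field F r \<and>
        (\<forall>a. pos F r a \<longrightarrow> (\<exists>b\<in>carrier F. a = b \<otimes>\<^bsub>F\<^esub> b))) \<and>
     (\<forall>p\<in>carrier (univ_poly F (carrier F)).
        odd (degree p) \<longrightarrow> (\<exists>x\<in>carrier F. ring.eval F p x = \<zero>\<^bsub>F\<^esub>))"


section \<open>Valuation rings and residue fields\<close>

text \<open>
  Valuations are considered up to equivalence, that is, a valuation \<open>v\<close> on \<open>K\<close> is given by its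
  valuation ring \<open>A = {x. v x \<ge> 0}\<close>; the trivial valuation is \<open>A = carrier K\<close>, and
  \<open>v\<close> is finer than \<open>w\<close> iff the valuation ring of \<open>v\<close> is contained in that of \<open>w\<close>.
\<close>

definition valuation_ring :: "('a, 'b) ring_scheme \<Rightarrow> 'a set \<Rightarrow> bool" where
  "valuation_ring K A \<longleftrightarrow>
     field K \<and> subring A K \<and> (\<forall>x\<in>carrier K - {\<zero>\<^bsub>K\<^esub>}. x \<in> A \<or> inv\<^bsub>K\<^esub> x \<in> A)"

abbreviation val_units :: "('a, 'b) ring_scheme \<Rightarrow> 'a set \<Rightarrow> 'a set" where
  "val_units K A \<equiv> Units (K\<lparr>carrier := A\<rparr>)"

definition max_ideal :: "('a, 'b) ring_scheme \<Rightarrow> 'a set \<Rightarrow> 'a set" where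
  "max_ideal K A = A - val_units K A"

definition residue_field :: "('a, 'b) ring_scheme \<Rightarrow> 'a set \<Rightarrow> 'a set ring" where
  "residue_field K A = (K\<lparr>carrier := A\<rparr>) Quot (max_ideal K A)"

definition residue :: "('a, 'b) ring_scheme \<Rightarrow> 'a set \<Rightarrow> 'a \<Rightarrow> 'a set" where
  "residue K A a = max_ideal K A +>\<^bsub>K\<lparr>carrier := A\<rparr>\<^esub> a"


section \<open>Henselian valuations\<close>

text \<open>Polynomials are lists of coefficients with the leading one first. The derivative below need
  not be normalised (in positive characteristic), which is irrelevant for its evaluation.\<close>

fun formal_deriv :: "('a, 'b) ring_scheme \<Rightarrow> 'a list \<Rightarrow> 'a list" where
  "formal_deriv K [] = []"
| "formal_deriv K [c] = []"
| "formal_deriv K (c # d # p) = ([length (d # p)] \<cdot>\<^bsub>K\<^esub> c) # formal_deriv K (d # p)"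

text \<open>Hensel's lemma: simple zeros of the reduction of \<open>f \<in> A[X]\<close> lift to zeros of \<open>f\<close> in \<open>A\<close>.\<close>

definition henselian :: "('a, 'b) ring_scheme \<Rightarrow> 'a set \<Rightarrow> bool" where
  "henselian K A \<longleftrightarrow>
     valuation_ring K A \<and>
     (\<forall>f\<in>carrier (univ_poly K A). \<forall>a\<in>A.
        ring.eval K f a \<in> max_ideal K A \<and> ring.eval K (formal_deriv K f) a \<notin> max_ideal K A \<longrightarrow>
        (\<exists>b\<in>A. ring.eval K f b = \<zero>\<^bsub>K\<^esub> \<and> residue K A b = residue K A a))"

definition almost_real_closed :: "('a, 'b) ring_scheme \<Rightarrow> bool" where
  "almost_real_closed K \<longleftrightarrow> field K \<and> (\<exists>A. henselian K A \<and> real_closed (residue_field K A))"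

text \<open>The canonical henselian valuation of an almost real closed field is its finest henselian
  valuation.\<close>

definition canonical_henselian :: "('a, 'b) ring_scheme \<Rightarrow> 'a set \<Rightarrow> bool" where
  "canonical_henselian K A \<longleftrightarrow> henselian K A \<and> (\<forall>B. henselian K B \<longrightarrow> A \<subseteq> B)"


section \<open>Angular component maps\<close>

text \<open>The induced order on the residue field: the residue of a unit \<open>a\<close> is positive iff \<open>a\<close> is.
  This is independent of the choice of \<open>a\<close> when \<open>A\<close> is convex, in particular when it is henselian.\<close>

definition residue_order :: "('a, 'b) ring_scheme \<Rightarrow> 'a rel \<Rightarrow> 'a set \<Rightarrow> 'a set rel" where
  "residue_order K r A =
     {(S, T). S \<in> carrier (residue_field K A) \<and> T \<in> carrier (residue_field K A) \<and>
        (S = T \<or> (\<exists>a\<in>val_units K A. pos K r a \<and> T \<ominus>\<^bsub>residue_field K A\<^esub> S = residue K A a))}"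

definition angular_component :: "('a, 'b) ring_scheme \<Rightarrow> 'a set \<Rightarrow> ('a \<Rightarrow> 'a set) \<Rightarrow> bool" where
  "angular_component K A ac \<longleftrightarrow>
     ac \<in> carrier K \<rightarrow> carrier (residue_field K A) \<and>
     ac \<zero>\<^bsub>K\<^esub> = \<zero>\<^bsub>residue_field K A\<^esub> \<and>
     ac \<in> hom (mult_of K) (mult_of (residue_field K A)) \<and>
     (\<forall>u\<in>val_units K A. ac u = residue K A u)"

definition compatible :: "('a, 'b) ring_scheme \<Rightarrow> 'a rel \<Rightarrow> 'a set \<Rightarrow> ('a \<Rightarrow> 'a set) \<Rightarrow> bool" where
  "compatible K r A ac \<longleftrightarrow>
     (\<forall>x\<in>carrier K. pos K r x \<longleftrightarrow> pos (residue_field K A) (residue_order K r A) (ac x))"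

end

theory Submission
  imports Defs
begin

text \<open>
  Let \<open>v\<close> be the valuation of \<open>A\<close>, and let \<open>U\<close> be the group of positive units of \<open>A\<close>. On \<open>U\<close> an
  angular component has to be the residue map, and the task is to extend it to all of the
  multiplicative group of \<open>K\<close> so that signs are respected. The key is that \<open>U\<close> is divisible:
  there is then a retraction \<open>\<rho>\<close> of the multiplicative group of \<open>K\<close> onto \<open>U\<close>
  (\<open>divisible_subgroup_retract\<close>), and \<open>ac x = residue (sgn x * \<rho> x)\<close> is an angular component with
  the right signs. It agrees with the residue map on negative units as well, because \<open>\<rho>\<close> sends the
  element \<open>- 1\<close> of order two to a positive element of order at most two, that is, to \<open>1\<close>
  (\<open>angular_component_if_retract\<close>).

  Divisibility comes from a henselian valuation ring \<open>B\<close> with real closed residue field; the finest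
  henselian valuation ring \<open>A\<close> is contained in it. The residue of a positive unit \<open>u\<close> of \<open>B\<close> has
  roots of odd order, being zeros of odd degree polynomials, and \<open>u\<close> or \<open>- u\<close> has a residual square
  root. These roots lift by Hensel's lemma, so \<open>u\<close> has a square root and roots of odd order, hence
  positive roots of every order (\<open>positive_unit_root\<close>). If \<open>u\<close> is a unit of \<open>A\<close>, so are its roots,
  as valuation rings are integrally closed (\<open>unit_if_power_unit\<close>).

  For compatibility with the induced order, \<open>A\<close> has to be convex: the residue of a negative unit
  must not be the residue of a positive one. Henselianity yields this by applying Hensel's lemma to
  \<open>X\<^sup>2 + X + m\<close> for \<open>m\<close> in the maximal ideal (\<open>max_ideal_less_one\<close>, \<open>positive_units_add\<close>). The same
  argument shows that residue characteristics are zero, which makes \<open>X\<^sup>n - a\<close> separable.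
\<close>


section \<open>Divisible subgroups are direct factors\<close>

text \<open>
  A divisible subgroup is injective, hence a direct factor. Zorn's lemma gives a subgroup \<open>M\<close>
  maximal with \<open>M \<inter> U = {\<one>}\<close>; the point is that \<open>M U\<close> is everything. If \<open>x\<close> lies outside
  \<open>M U\<close>, divisibility of \<open>U\<close> corrects \<open>x\<close> by an element of \<open>U\<close> to some \<open>y\<close> whose powers meet
  \<open>M U\<close> only in \<open>M\<close>. Adjoining \<open>y\<close> to \<open>M\<close> then creates no new intersection with \<open>U\<close>, which
  contradicts maximality. The retraction is the projection along \<open>M\<close>.
\<close>

lemma (in comm_group) divisible_subgroup_retract:
  assumes U: "subgroup U G"
    and div: "\<And>u n. u \<in> U \<Longrightarrow> 0 < (n::nat) \<Longrightarrow> \<exists>w\<in>U. w [^] n = u"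
  shows "\<exists>\<rho>\<in>hom G (G\<lparr>carrier := U\<rparr>). \<forall>u\<in>U. \<rho> u = u"
proof -
  define \<A> where "\<A> = {H. subgroup H G \<and> H \<inter> U = {\<one>}}"
  have "\<exists>M\<in>\<A>. \<forall>L\<in>\<A>. M \<subseteq> L \<longrightarrow> L = M"
  proof (rule subset_Zorn_nonempty)
    have "{\<one>} \<in> \<A>"
      using triv_subgroup subgroup.one_closed[OF U] by (auto simp: \<A>_def)
    then show "\<A> \<noteq> {}" by blast
  next
    fix \<C> assume ne: "\<C> \<noteq> {}" and ch: "subset.chain \<A> \<C>"
    have sub: "subgroup H G" "H \<inter> U = {\<one>}" if "H \<in> \<C>" for H
      using ch that by (auto simp: subset.chain_def \<A>_def)
    have "subgroup (\<Union>\<C>) G"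
    proof (rule subgroupI)
      show "\<Union>\<C> \<subseteq> carrier G" using subgroup.subset[OF sub(1)] by blast
      show "\<Union>\<C> \<noteq> {}" using ne subgroup.one_closed[OF sub(1)] by blast
      show "inv a \<in> \<Union>\<C>" if "a \<in> \<Union>\<C>" for a
        using that subgroup.m_inv_closed[OF sub(1)] by blast
      show "a \<otimes> b \<in> \<Union>\<C>" if a: "a \<in> \<Union>\<C>" and b: "b \<in> \<Union>\<C>" for a b
      proof -
        obtain S T where ST: "S \<in> \<C>" "a \<in> S" "T \<in> \<C>" "b \<in> T" using a b by blast
        have "S \<subseteq> T \<or> T \<subseteq> S" using ch ST(1,3) by (auto simp: subset.chain_def)
        then show ?thesis using ST subgroup.m_closed[OF sub(1)] by blast
      qed
    qed
    moreover have "\<Union>\<C> \<inter> U = {\<one>}" using ne sub(2) by blast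
    ultimately show "\<Union>\<C> \<in> \<A>" by (simp add: \<A>_def)
  qed
  then obtain M where M: "subgroup M G" and MU: "M \<inter> U = {\<one>}"
    and max: "\<And>L. \<lbrakk>subgroup L G; L \<inter> U = {\<one>}; M \<subseteq> L\<rbrakk> \<Longrightarrow> L = M"
    unfolding \<A>_def by (metis (mono_tags, lifting) mem_Collect_eq)
  have Mc: "\<And>h. h \<in> M \<Longrightarrow> h \<in> carrier G" and Uc: "\<And>u. u \<in> U \<Longrightarrow> u \<in> carrier G"
    using subgroup.subset[OF M] subgroup.subset[OF U] by auto
  define N where "N = M <#> U"
  have N: "subgroup N G" unfolding N_def by (rule mult_subgroups[OF M U])
  have NI: "h \<otimes> u \<in> N" if "h \<in> M" "u \<in> U" for h u
    using that unfolding N_def set_mult_def by blast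
  have NE: "\<exists>h\<in>M. \<exists>u\<in>U. x = h \<otimes> u" if "x \<in> N" for x
    using that unfolding N_def set_mult_def by blast
  have MN: "h \<in> N" if "h \<in> M" for h
    using NI[OF that subgroup.one_closed[OF U]] Mc[OF that] by simp
  have UN: "u \<in> N" if "u \<in> U" for u
    using NI[OF subgroup.one_closed[OF M] that] Uc[OF that] by simp
  have "x \<in> N" if x: "x \<in> carrier G" for x
  proof (rule ccontr)
    assume xN: "x \<notin> N"
    have "\<exists>y\<in>carrier G. y \<notin> N \<and> (\<forall>k::int. y [^] k \<in> N \<longrightarrow> y [^] k \<in> M)"
    proof (cases "\<exists>n::nat. 0 < n \<and> x [^] n \<in> N")
      case False
      have "k = 0" if "x [^] k \<in> N" for k :: int
      proof (rule ccontr)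
        assume "k \<noteq> 0"
        then have "0 < nat \<bar>k\<bar>" by simp
        moreover have "x [^] nat \<bar>k\<bar> \<in> N"
        proof (cases "0 \<le> k")
          case True
          then show ?thesis using that by (simp add: int_pow_int[symmetric])
        next
          case False
          then have "x [^] nat \<bar>k\<bar> = inv (x [^] k)"
            using x by (simp add: int_pow_int[symmetric] int_pow_neg)
          then show ?thesis using that subgroup.m_inv_closed[OF N] by simp
        qed
        ultimately show False using False by blast
      qed
      then show ?thesis using x xN subgroup.one_closed[OF M] by (metis int_pow_0)
    next
      case True
      define n where "n = (LEAST n. 0 < n \<and> x [^] (n::nat) \<in> N)"
      have n: "0 < n" "x [^] n \<in> N"
        using LeastI_ex[OF True] by (auto simp: n_def)
      have least: "j = 0" if "j < n" "x [^] j \<in> N" for j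
        using not_less_Least[of j "\<lambda>n. 0 < n \<and> x [^] n \<in> N"] that by (auto simp: n_def)
      obtain h u where hu: "h \<in> M" "u \<in> U" "x [^] n = h \<otimes> u" using NE[OF n(2)] by blast
      \<comment> \<open>Dividing \<open>x\<close> by an \<open>n\<close>-th root of \<open>u\<close> moves its \<open>n\<close>-th power from \<open>M U\<close> into \<open>M\<close>,
        and does not change which powers lie in \<open>M U\<close>.\<close>
      obtain w where w: "w \<in> U" "w [^] n = u" using div[OF hu(2) n(1)] by blast
      note c = x Mc[OF hu(1)] Uc[OF hu(2)] Uc[OF w(1)]
      define y where "y = x \<otimes> inv w"
      have y: "y \<in> carrier G" and xy: "x = y \<otimes> w"
        using c by (auto simp: y_def m_assoc)
      have "y [^] n \<otimes> u = h \<otimes> u"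
        using hu(3) w(2) y c by (simp add: xy nat_pow_distrib)
      then have yn: "y [^] n = h" using y c by simp
      have yN: "y \<notin> N" using xN xy UN[OF w(1)] subgroup.m_closed[OF N] by blast
      have "y [^] k \<in> M" if k: "y [^] k \<in> N" for k :: int
      proof -
        \<comment> \<open>By minimality of \<open>n\<close>, only exponents divisible by \<open>n\<close> occur.\<close>
        have nk: "y [^] (int n * (k div int n)) \<in> M"
          using subgroup_int_pow_closed[OF M hu(1)] yn y
          by (simp add: int_pow_pow[symmetric] int_pow_int)
        have "x [^] k = y [^] k \<otimes> w [^] k" using y c by (simp add: xy int_pow_distrib)
        also have "\<dots> \<in> N"
          using k UN[OF subgroup_int_pow_closed[OF U w(1)]] subgroup.m_closed[OF N] by blast
        finally have xk: "x [^] k \<in> N" .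
        have "x [^] (k mod int n) = x [^] (k + int n * - (k div int n))"
          by (simp add: minus_mult_div_eq_mod)
        also have "\<dots> = x [^] k \<otimes> (x [^] n) [^] - (k div int n)"
          using x by (simp add: int_pow_mult int_pow_pow int_pow_int[symmetric] del: mult_minus_right)
        also have "\<dots> \<in> N"
          using xk subgroup_int_pow_closed[OF N n(2)] subgroup.m_closed[OF N] by blast
        finally have "x [^] nat (k mod int n) \<in> N"
          using n(1) by (simp add: int_pow_int[symmetric])
        moreover have "nat (k mod int n) < n"
          using n(1) by (simp add: nat_less_iff)
        ultimately have "nat (k mod int n) = 0"
          using least by blast
        moreover have "0 \<le> k mod int n" using n(1) by simp
        ultimately have "k mod int n = 0" by linarith
        then have "k = int n * (k div int n)" by (metis add_0_right mult_div_mod_eq)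
        then show ?thesis using nk by metis
      qed
      then show ?thesis using y yN by blast
    qed
    then obtain y where y: "y \<in> carrier G" "y \<notin> N"
      and pow: "\<And>k::int. y [^] k \<in> N \<Longrightarrow> y [^] k \<in> M" by blast
    define L where "L = M <#> range (\<lambda>k::int. y [^] k)"
    have cyc: "subgroup (range (\<lambda>k::int. y [^] k)) G"
      using subgroup_of_powers y by simp
    have L: "subgroup L G" unfolding L_def by (rule mult_subgroups[OF M cyc])
    have "M \<subseteq> L"
    proof
      fix h assume "h \<in> M"
      then have "h \<otimes> y [^] (0::int) \<in> L" unfolding L_def set_mult_def by blast
      then show "h \<in> L" using Mc \<open>h \<in> M\<close> by simp
    qed
    moreover have "L \<inter> U = {\<one>}"
    proof -
      have "u = \<one>" if u: "u \<in> U" "u \<in> L" for u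
      proof -
        obtain h k where hk: "h \<in> M" "u = h \<otimes> y [^] (k::int)"
          using u(2) unfolding L_def set_mult_def by blast
        have "y [^] k = inv h \<otimes> u" using hk Mc y by (simp add: m_assoc[symmetric])
        then have "y [^] k \<in> M"
          using pow NI[OF subgroup.m_inv_closed[OF M hk(1)] u(1)] by metis
        then have "u \<in> M" using hk subgroup.m_closed[OF M] by simp
        then show ?thesis using u(1) MU by blast
      qed
      then show ?thesis using subgroup.one_closed[OF L] subgroup.one_closed[OF U] by blast
    qed
    ultimately have "L = M" using max L by blast
    moreover have "y \<in> L"
    proof -
      have "\<one> \<otimes> y [^] (1::int) \<in> L"
        unfolding L_def set_mult_def using subgroup.one_closed[OF M] by blast
      then show ?thesis using y by simp
    qed
    ultimately show False using MN y by blast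
  qed
  then have ex: "\<exists>u. u \<in> U \<and> (\<exists>h\<in>M. x = h \<otimes> u)" if "x \<in> carrier G" for x
    using NE that by blast
  have uniq: "u = u'" if "h \<in> M" "h' \<in> M" "u \<in> U" "u' \<in> U" "h \<otimes> u = h' \<otimes> u'" for h h' u u'
  proof -
    note c = Mc[OF that(1)] Mc[OF that(2)] Uc[OF that(3)] Uc[OF that(4)]
    have "inv h' \<otimes> h = inv h' \<otimes> (h \<otimes> u) \<otimes> inv u"
      using c by (simp add: m_assoc)
    also have "\<dots> = u' \<otimes> inv u"
      unfolding that(5) using c by (simp add: m_assoc[symmetric])
    finally have "u' \<otimes> inv u \<in> M \<inter> U"
      using that subgroup.m_inv_closed M U subgroup.m_closed by (metis IntI)
    then have "u' \<otimes> inv u = \<one>" using MU by blast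
    then have "u' \<otimes> inv u \<otimes> u = u" using that Uc by simp
    then show ?thesis using that Uc by (simp add: m_assoc)
  qed
  define \<rho> where "\<rho> x = (SOME u. u \<in> U \<and> (\<exists>h\<in>M. x = h \<otimes> u))" for x
  have \<rho>: "\<rho> x \<in> U" "\<exists>h\<in>M. x = h \<otimes> \<rho> x" if "x \<in> carrier G" for x
    using someI_ex[OF ex[OF that]] by (auto simp: \<rho>_def)
  have \<rho>_eq: "\<rho> (h \<otimes> u) = u" if "h \<in> M" "u \<in> U" for h u
    using \<rho>[of "h \<otimes> u"] uniq that Mc Uc by (metis m_closed)
  have "\<rho> \<in> hom G (G\<lparr>carrier := U\<rparr>)"
  proof (rule homI)
    show "\<rho> x \<in> carrier (G\<lparr>carrier := U\<rparr>)" if "x \<in> carrier G" for x using \<rho> that by simp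
    fix x y assume xy: "x \<in> carrier G" "y \<in> carrier G"
    obtain h k where hk: "h \<in> M" "x = h \<otimes> \<rho> x" "k \<in> M" "y = k \<otimes> \<rho> y" using \<rho>(2) xy by blast
    have "x \<otimes> y = (h \<otimes> k) \<otimes> (\<rho> x \<otimes> \<rho> y)"
      using hk(1,3) \<rho>(1) xy Mc Uc
      by (subst hk(2), subst hk(4)) (simp add: m_ac)
    then show "\<rho> (x \<otimes> y) = \<rho> x \<otimes>\<^bsub>G\<lparr>carrier := U\<rparr>\<^esub> \<rho> y"
      using \<rho>_eq hk \<rho>(1) xy subgroup.m_closed M U by (metis monoid.simps(1) partial_object.update_convs(1) monoid.surjective)
  qed
  moreover have "\<forall>u\<in>U. \<rho> u = u"
    using \<rho>_eq[OF subgroup.one_closed[OF M]] Uc by simp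
  ultimately show ?thesis by blast
qed


section \<open>Positive elements of an ordered field\<close>

locale ord_field = field K for K (structure) +
  fixes r
  assumes ordered: "ordered_field K r"
begin

abbreviation positive :: "'a \<Rightarrow> bool" where
  "positive \<equiv> pos K r"

lemma positive_carrier: "positive x \<Longrightarrow> x \<in> carrier K"
  using ordered by (auto simp: pos_def ordered_field_def order_on_defs)

lemma positive_nonzero: "positive x \<Longrightarrow> x \<noteq> \<zero>"
  by (simp add: pos_def)

lemma positive_asym:
  assumes "positive x"
  shows "\<not> positive (\<ominus> x)"
proof
  assume "positive (\<ominus> x)"
  then have "(\<zero> \<oplus> x, \<ominus> x \<oplus> x) \<in> r"
    using ordered positive_carrier[OF assms] unfolding pos_def ordered_field_def by blast
  then have "(x, \<zero>) \<in> r"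
    using positive_carrier[OF assms] by (simp add: l_neg)
  then show False
    using assms ordered by (auto simp: pos_def ordered_field_def order_on_defs dest: antisymD)
qed

lemma positive_or_neg:
  assumes "x \<in> carrier K" "x \<noteq> \<zero>"
  shows "positive x \<or> positive (\<ominus> x)"
proof -
  have "(\<zero>, x) \<in> r \<or> (x, \<zero>) \<in> r"
    using ordered assms by (auto simp: ordered_field_def linear_order_on_def total_on_def)
  moreover have "(\<zero>, \<ominus> x) \<in> r" if "(x, \<zero>) \<in> r"
  proof -
    have "(x \<oplus> \<ominus> x, \<zero> \<oplus> \<ominus> x) \<in> r"
      using ordered assms that unfolding ordered_field_def by blast
    then show ?thesis using assms by (simp add: r_neg)
  qed
  ultimately show ?thesis
    using assms by (auto simp: pos_def)
qed

lemma positive_add: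
  assumes x: "positive x" and y: "positive y"
  shows "positive (x \<oplus> y)"
proof -
  note c = positive_carrier[OF x] positive_carrier[OF y]
  have "(\<zero> \<oplus> y, x \<oplus> y) \<in> r"
    using ordered x c unfolding ordered_field_def pos_def by blast
  then have "(\<zero>, x \<oplus> y) \<in> r"
    using ordered y c unfolding ordered_field_def pos_def order_on_defs
    by (auto dest: transD)
  moreover have "x \<oplus> y \<noteq> \<zero>"
  proof
    assume "x \<oplus> y = \<zero>"
    then have "y = \<ominus> x" using c by (metis a_comm minus_equality)
    then show False using positive_asym[OF x] y by simp
  qed
  ultimately show ?thesis by (simp add: pos_def)
qed

lemma positive_mult:
  assumes "positive x" "positive y"
  shows "positive (x \<otimes> y)"
  using ordered assms positive_carrier[OF assms(1)] positive_carrier[OF assms(2)]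
  by (auto simp: pos_def ordered_field_def integral_iff)

lemma positive_square:
  assumes "x \<in> carrier K" "x \<noteq> \<zero>"
  shows "positive (x \<otimes> x)"
  using positive_or_neg[OF assms] positive_mult[of x x] positive_mult[of "\<ominus> x" "\<ominus> x"] assms
  by (auto simp: l_minus r_minus)

lemma positive_one: "positive \<one>"
  using positive_square[of \<one>] by simp

lemma positive_mult_left_iff:
  assumes "positive x" "y \<in> carrier K"
  shows "positive (x \<otimes> y) \<longleftrightarrow> positive y"
proof
  assume xy: "positive (x \<otimes> y)"
  then have "y \<noteq> \<zero>"
    using positive_nonzero[OF xy] positive_carrier[OF assms(1)] by auto
  moreover have "positive (\<ominus> (x \<otimes> y))" if "positive (\<ominus> y)"
    using positive_mult[OF assms(1) that] assms positive_carrier by (simp add: r_minus)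
  ultimately show "positive y" using positive_asym[OF xy] positive_or_neg assms(2) by blast
qed (use positive_mult assms in blast)

lemma positive_inv:
  assumes "positive x"
  shows "positive (inv x)"
proof -
  have x: "x \<in> Units K" using positive_carrier positive_nonzero assms by (simp add: field_Units)
  then have "positive (x \<otimes> inv x)" using positive_one by simp
  then show ?thesis using positive_mult_left_iff assms x by blast
qed

lemma positive_nat_pow: "positive x \<Longrightarrow> positive (x [^] (n::nat))"
  by (induction n) (auto intro: positive_one positive_mult)

lemma positive_nat_multiple: "positive ([Suc n] \<cdot> \<one>)"
proof (induction n)
  case 0 then show ?case using positive_one by simp
next
  case (Suc n)
  then show ?case using positive_add[OF Suc positive_one] by (simp add: add.nat_pow_Suc)
qed

text \<open>An odd power differs from its base by a power of a square.\<close>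

lemma positive_odd_root:
  assumes "x \<in> carrier K" "odd (n::nat)" "positive (x [^] n)"
  shows "positive x"
proof -
  obtain m where n: "n = Suc (2 * m)" using assms(2) by (metis oddE Suc_eq_plus1)
  have "x \<noteq> \<zero>" using positive_nonzero[OF assms(3)] n by auto
  then have sq: "positive ((x \<otimes> x) [^] m)"
    using positive_square positive_nat_pow assms(1) by blast
  have "x [^] n = (x \<otimes> x) [^] m \<otimes> x"
    using assms(1) by (simp add: n nat_pow_mult[symmetric] mult_2 nat_pow_distrib)
  then show ?thesis using positive_mult_left_iff[OF sq] assms by simp
qed

end


section \<open>Valuation rings and their residue maps\<close>

text \<open>Every nonzero element of a field is a unit, so the theory of \<^const>\<open>units_of\<close> applies to the
  multiplicative group.\<close>

lemma (in field) mult_of_eq_units_of: "mult_of R = units_of R"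
  by (auto simp: Ring_Divisibility.mult_of_def units_of_def field_Units)

lemma (in field) mult_of_comm_group: "comm_group (mult_of R)"
  by (simp add: mult_of_eq_units_of units_comm_group)

locale valued_field = field K for K (structure) +
  fixes A
  assumes valuation: "valuation_ring K A"
begin

lemma subring_A: "subring A K"
  using valuation by (simp add: valuation_ring_def)

lemmas A_carrier = subsetD[OF subringE(1)[OF subring_A]]
  and A_zero = subringE(2)[OF subring_A]
  and A_one = subringE(3)[OF subring_A]
  and A_neg = subringE(5)[OF subring_A]
  and A_mult = subringE(6)[OF subring_A]
  and A_add = subringE(7)[OF subring_A]

lemma A_nat_pow: "x \<in> A \<Longrightarrow> x [^] (n::nat) \<in> A"
  by (induction n) (auto intro: A_one A_mult)

lemma A_nat_multiple: "[(n::nat)] \<cdot> \<one> \<in> A"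
  by (induction n) (auto intro: A_zero A_one A_add simp: add.nat_pow_Suc)

lemma A_or_inv: "x \<in> carrier K \<Longrightarrow> x \<noteq> \<zero> \<Longrightarrow> x \<in> A \<or> inv x \<in> A"
  using valuation by (simp add: valuation_ring_def)

lemma nonzero_inv:
  assumes "x \<in> carrier K" "x \<noteq> \<zero>"
  shows "inv x \<in> carrier K" "inv x \<noteq> \<zero>" "x \<otimes> inv x = \<one>" "inv x \<otimes> x = \<one>" "inv (inv x) = x"
proof -
  have x: "x \<in> Units K" using assms by (simp add: field_Units)
  then show "inv x \<in> carrier K" "x \<otimes> inv x = \<one>" "inv x \<otimes> x = \<one>" "inv (inv x) = x"
    by auto
  then show "inv x \<noteq> \<zero>" using assms(1) by auto
qed

lemma inv_nonzero_mult:
  assumes "x \<in> carrier K" "x \<noteq> \<zero>" "y \<in> carrier K" "y \<noteq> \<zero>"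
  shows "inv (x \<otimes> y) = inv x \<otimes> inv y"
proof (rule comm_inv_char)
  note c = assms nonzero_inv[OF assms(1,2)] nonzero_inv[OF assms(3,4)]
  have "x \<otimes> y \<otimes> (inv x \<otimes> inv y) = (x \<otimes> inv x) \<otimes> (y \<otimes> inv y)"
    using c(1,3,5,10) by (simp add: m_ac)
  then show "x \<otimes> y \<otimes> (inv x \<otimes> inv y) = \<one>" using c by simp
qed (use assms nonzero_inv in auto)

lemma val_units_iff: "u \<in> val_units K A \<longleftrightarrow> u \<in> A \<and> u \<noteq> \<zero> \<and> inv u \<in> A"
proof
  assume "u \<in> val_units K A"
  then obtain w where w: "u \<in> A" "w \<in> A" "w \<otimes> u = \<one>" "u \<otimes> w = \<one>"
    by (auto simp: Units_def)
  then have "u \<noteq> \<zero>" using A_carrier by auto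
  moreover have "inv u = w" using w A_carrier by (simp add: comm_inv_char)
  ultimately show "u \<in> A \<and> u \<noteq> \<zero> \<and> inv u \<in> A" using w by simp
next
  assume "u \<in> A \<and> u \<noteq> \<zero> \<and> inv u \<in> A"
  then show "u \<in> val_units K A"
    using nonzero_inv(3,4)[of u] A_carrier by (auto simp: Units_def)
qed

lemma units_subgroup: "subgroup (val_units K A) (mult_of K)"
proof -
  interpret G: comm_group "mult_of K" by (rule mult_of_comm_group)
  show ?thesis
  proof (rule G.subgroupI)
    show "val_units K A \<subseteq> carrier (mult_of K)"
      using A_carrier by (auto simp: val_units_iff)
    show "val_units K A \<noteq> {}"
      using A_one val_units_iff[of \<one>] by auto
    show "inv\<^bsub>mult_of K\<^esub> u \<in> val_units K A" if "u \<in> val_units K A" for u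
    proof -
      have "u \<in> Units K" using that A_carrier by (simp add: val_units_iff field_Units)
      then have "inv\<^bsub>mult_of K\<^esub> u = inv u" by (simp add: mult_of_eq_units_of units_of_inv)
      then show ?thesis using that nonzero_inv A_carrier by (simp add: val_units_iff)
    qed
    show "u \<otimes>\<^bsub>mult_of K\<^esub> w \<in> val_units K A" if "u \<in> val_units K A" "w \<in> val_units K A" for u w
    proof -
      have "inv (u \<otimes> w) = inv u \<otimes> inv w"
        using that A_carrier inv_nonzero_mult by (simp add: val_units_iff)
      then show ?thesis using that A_carrier A_mult by (simp add: val_units_iff integral_iff)
    qed
  qed
qed

lemmas units_mult = subgroup.m_closed[OF units_subgroup, simplified]

lemma units_nat_pow: "u \<in> val_units K A \<Longrightarrow> u [^] (n::nat) \<in> val_units K A"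
proof (induction n)
  case 0 then show ?case using A_one by (simp add: val_units_iff)
next
  case (Suc n) then show ?case using units_mult by simp
qed

lemma units_uminus: "u \<in> val_units K A \<Longrightarrow> \<ominus> u \<in> val_units K A"
proof -
  assume u: "u \<in> val_units K A"
  then have "u \<in> carrier K" "inv u \<in> carrier K" "u \<otimes> inv u = \<one>"
    using A_carrier nonzero_inv by (auto simp: val_units_iff)
  then have "inv (\<ominus> u) = \<ominus> (inv u)"
    by (intro comm_inv_char) (auto simp: l_minus r_minus)
  then show ?thesis using u A_neg A_carrier by (simp add: val_units_iff add.inv_eq_1_iff)
qed

text \<open>
  Valuation rings are integrally closed; for radicals this is immediate: if \<open>x\<close> were not in \<open>A\<close>,
  then \<open>inv x\<close> would be, and \<open>x\<close> is \<open>x [^] n\<close> times a power of \<open>inv x\<close>.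
\<close>

lemma A_if_power_in_A:
  assumes x: "x \<in> carrier K" and n: "0 < (n::nat)" and xn: "x [^] n \<in> A"
  shows "x \<in> A"
proof (rule ccontr)
  assume xA: "x \<notin> A"
  then have nz: "x \<noteq> \<zero>" using A_zero by auto
  note inv = nonzero_inv[OF x nz]
  have invA: "inv x \<in> A" using A_or_inv[OF x nz] xA by simp
  obtain m where m: "n = Suc m" using n gr0_conv_Suc by blast
  have "x [^] m \<otimes> inv x [^] m = \<one>"
    using x inv by (simp add: nat_pow_distrib[symmetric])
  then have "x = x [^] n \<otimes> inv x [^] m"
    using x inv by (simp add: m m_ac)
  also have "\<dots> \<in> A" using xn A_nat_pow[OF invA] by (rule A_mult)
  finally show False using xA by simp
qed

text \<open>This makes roots found in a coarser valuation ring units of the finer one.\<close>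

lemma unit_if_power_unit:
  assumes x: "x \<in> carrier K" and n: "0 < (n::nat)" and xn: "x [^] n \<in> val_units K A"
  shows "x \<in> val_units K A"
proof -
  have nz: "x \<noteq> \<zero>" using xn n by (auto simp: val_units_iff nat_pow_zero)
  note inv = nonzero_inv[OF x nz]
  have "x [^] n \<otimes> inv x [^] n = \<one>"
    using x inv by (simp add: nat_pow_distrib[symmetric])
  then have "inv (x [^] n) = inv x [^] n"
    by (rule comm_inv_char[rotated 2]) (use x inv(1) in auto)
  then have "inv x \<in> A" "x \<in> A"
    using xn A_if_power_in_A[OF _ n] x inv by (auto simp: val_units_iff)
  then show ?thesis using nz by (simp add: val_units_iff)
qed

lemma max_ideal_mult:
  assumes "x \<in> max_ideal K A" "y \<in> A"
  shows "x \<otimes> y \<in> max_ideal K A"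
proof -
  have "x \<in> val_units K A" if u: "x \<otimes> y \<in> val_units K A"
  proof -
    have "x \<in> A" using assms by (simp add: max_ideal_def)
    moreover from u have "x \<noteq> \<zero>" using A_carrier assms by (auto simp: val_units_iff)
    moreover have "inv x = y \<otimes> inv (x \<otimes> y)"
    proof (rule comm_inv_char)
      show "x \<otimes> (y \<otimes> inv (x \<otimes> y)) = \<one>"
        using u assms A_carrier nonzero_inv by (simp add: val_units_iff m_assoc[symmetric] max_ideal_def)
    qed (use u assms A_carrier in \<open>auto simp: val_units_iff max_ideal_def\<close>)
    ultimately show ?thesis using u assms A_mult by (simp add: val_units_iff)
  qed
  then show ?thesis using assms A_mult by (auto simp: max_ideal_def)
qed

lemma max_ideal_zero: "\<zero> \<in> max_ideal K A"
  by (simp add: max_ideal_def val_units_iff A_zero)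

lemma max_ideal_add:
  assumes x: "x \<in> max_ideal K A" and y: "y \<in> max_ideal K A"
  shows "x \<oplus> y \<in> max_ideal K A"
proof -
  \<comment> \<open>Divide by the summand of smaller value: the quotient then lies in \<open>A\<close>.\<close>
  have step: "a \<oplus> b \<in> max_ideal K A"
    if ab: "a \<in> max_ideal K A" "b \<in> max_ideal K A" "a \<noteq> \<zero>" and q: "b \<otimes> inv a \<in> A" for a b
  proof -
    have c: "a \<in> carrier K" "b \<in> carrier K" using ab A_carrier by (auto simp: max_ideal_def)
    have "a \<otimes> (\<one> \<oplus> b \<otimes> inv a) = a \<oplus> b \<otimes> (a \<otimes> inv a)"
      using c nonzero_inv(1)[OF c(1) ab(3)] by (simp add: r_distr m_ac)
    also have "\<dots> = a \<oplus> b" using c nonzero_inv(3)[OF c(1) ab(3)] by simp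
    finally show ?thesis using max_ideal_mult[OF ab(1) A_add[OF A_one q]] by simp
  qed
  have c: "x \<in> carrier K" "y \<in> carrier K" using x y A_carrier by (auto simp: max_ideal_def)
  show ?thesis
  proof (cases "x = \<zero> \<or> y = \<zero>")
    case True
    then show ?thesis using x y c by auto
  next
    case False
    note ix = nonzero_inv[OF c(1)] and iy = nonzero_inv[OF c(2)]
    have "y \<otimes> inv x \<noteq> \<zero>" using False ix iy c by (simp add: integral_iff)
    moreover have "inv (y \<otimes> inv x) = x \<otimes> inv y"
      using False ix iy(1) c by (simp add: inv_nonzero_mult m_comm)
    ultimately have "y \<otimes> inv x \<in> A \<or> x \<otimes> inv y \<in> A"
      using A_or_inv[of "y \<otimes> inv x"] False ix iy c by simp
    then show ?thesis using step[OF x y] step[OF y x] False c by (auto simp: a_comm)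
  qed
qed

text \<open>The residue field is built from the ring \<open>K\<lparr>carrier := A\<rparr>\<close>, where negation is defined with respect
  to the restricted carrier.\<close>

lemma minus_restrict: "a \<in> A \<Longrightarrow> \<ominus>\<^bsub>K\<lparr>carrier := A\<rparr>\<^esub> a = \<ominus> a"
proof -
  assume a: "a \<in> A"
  interpret R: ring "K\<lparr>carrier := A\<rparr>" by (rule subring_is_ring[OF subring_A])
  show ?thesis
    using R.minus_equality[of "\<ominus> a" a] a A_neg A_carrier by (simp add: l_neg)
qed

lemma ideal_max: "ideal (max_ideal K A) (K\<lparr>carrier := A\<rparr>)"
proof -
  interpret R: cring "K\<lparr>carrier := A\<rparr>"
    using subcring_iff[OF subringE(1)[OF subring_A]] subcringI'[OF subring_A] by simp
  show ?thesis
  proof (rule idealI)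
    show "ring (K\<lparr>carrier := A\<rparr>)" by (rule R.ring_axioms)
    show "subgroup (max_ideal K A) (add_monoid (K\<lparr>carrier := A\<rparr>))"
    proof (rule R.add.subgroupI)
      show "\<ominus>\<^bsub>K\<lparr>carrier := A\<rparr>\<^esub> a \<in> max_ideal K A" if "a \<in> max_ideal K A" for a
      proof -
        have "a \<otimes> \<ominus> \<one> \<in> max_ideal K A" using max_ideal_mult[OF that A_neg[OF A_one]] .
        then show ?thesis
          using that A_carrier minus_restrict by (simp add: max_ideal_def r_minus)
      qed
    qed (use max_ideal_zero max_ideal_add in \<open>auto simp: max_ideal_def\<close>)
  next
    fix a x assume a: "a \<in> max_ideal K A" and x: "x \<in> carrier (K\<lparr>carrier := A\<rparr>)"
    then show "a \<otimes>\<^bsub>K\<lparr>carrier := A\<rparr>\<^esub> x \<in> max_ideal K A" using max_ideal_mult by simp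
    then show "x \<otimes>\<^bsub>K\<lparr>carrier := A\<rparr>\<^esub> a \<in> max_ideal K A"
      using a x A_carrier by (simp add: m_comm max_ideal_def)
  qed
qed

lemma residue_eq_iff:
  assumes "a \<in> A" "b \<in> A"
  shows "residue K A a = residue K A b \<longleftrightarrow> a \<ominus> b \<in> max_ideal K A"
proof -
  interpret R: ring "K\<lparr>carrier := A\<rparr>" by (rule subring_is_ring[OF subring_A])
  show ?thesis
    using R.quotient_eq_iff_same_a_r_cos[OF ideal_max] assms minus_restrict
    by (simp add: residue_def a_minus_def)
qed

lemma residue_hom: "ring_hom_ring (K\<lparr>carrier := A\<rparr>) (residue_field K A) (residue K A)"
  using ideal.rcos_ring_hom_ring[OF ideal_max] by (simp add: residue_field_def residue_def[abs_def])

lemma residue_surj: "S \<in> carrier (residue_field K A) \<Longrightarrow> \<exists>a\<in>A. S = residue K A a"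
  unfolding residue_field_def residue_def FactRing_def A_RCOSETS_def RCOSETS_def a_r_coset_def
  by auto

lemma residue_closed: "a \<in> A \<Longrightarrow> residue K A a \<in> carrier (residue_field K A)"
  using ring_hom_closed[OF ring_hom_ring.homh[OF residue_hom]] by simp

lemma residue_zero: "residue K A \<zero> = \<zero>\<^bsub>residue_field K A\<^esub>"
proof -
  interpret h: ring_hom_ring "K\<lparr>carrier := A\<rparr>" "residue_field K A" "residue K A" by (rule residue_hom)
  show ?thesis using h.hom_zero by simp
qed

lemma residue_mult:
  "a \<in> A \<Longrightarrow> b \<in> A \<Longrightarrow> residue K A (a \<otimes> b) = residue K A a \<otimes>\<^bsub>residue_field K A\<^esub> residue K A b"
proof -
  interpret h: ring_hom_ring "K\<lparr>carrier := A\<rparr>" "residue_field K A" "residue K A" by (rule residue_hom)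
  show "a \<in> A \<Longrightarrow> b \<in> A \<Longrightarrow> ?thesis" using h.hom_mult[of a b] by simp
qed

lemma residue_uminus:
  "a \<in> A \<Longrightarrow> residue K A (\<ominus> a) = \<ominus>\<^bsub>residue_field K A\<^esub> residue K A a"
proof -
  interpret h: ring_hom_ring "K\<lparr>carrier := A\<rparr>" "residue_field K A" "residue K A" by (rule residue_hom)
  show "a \<in> A \<Longrightarrow> ?thesis" using h.hom_a_inv[of a] minus_restrict[of a] by simp
qed

lemma residue_nat_pow:
  "a \<in> A \<Longrightarrow> residue K A (a [^] n) = residue K A a [^]\<^bsub>residue_field K A\<^esub> (n::nat)"
proof -
  interpret h: ring_hom_ring "K\<lparr>carrier := A\<rparr>" "residue_field K A" "residue K A" by (rule residue_hom)
  assume a: "a \<in> A"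
  show ?thesis
  proof (induction n)
    case 0 then show ?case using h.hom_one by simp
  next
    case (Suc n) then show ?case using a residue_mult A_nat_pow by simp
  qed
qed

lemma residue_nonzero_iff:
  assumes "a \<in> A"
  shows "residue K A a \<noteq> \<zero>\<^bsub>residue_field K A\<^esub> \<longleftrightarrow> a \<in> val_units K A"
  using residue_eq_iff[OF assms A_zero] assms A_carrier by (simp add: residue_zero a_minus_def max_ideal_def)

end


section \<open>The polynomials \<open>X\<^sup>n - c\<close>\<close>

context ring
begin

lemma eval_pure_poly:
  assumes "x \<in> carrier R" "c \<in> carrier R"
  shows "eval (\<one> # replicate k \<zero> @ [\<ominus> c]) x = x [^] Suc k \<ominus> c"
  using assms eval_replicate[of "[\<ominus> c]" x k] by (simp add: a_minus_def)

lemma formal_deriv_Cons: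
  "p \<noteq> [] \<Longrightarrow> formal_deriv R (c # p) = add_pow R (length p) c # formal_deriv R p"
  by (cases p) auto

lemma length_formal_deriv: "length (formal_deriv R p) = length p - 1"
  by (induction R p rule: formal_deriv.induct) auto

lemma eval_formal_deriv_const:
  "x \<in> carrier R \<Longrightarrow> eval (formal_deriv R (replicate k \<zero> @ [c])) x = \<zero>"
proof (induction k)
  case 0 then show ?case by simp
next
  case (Suc k)
  then show ?case by (simp add: formal_deriv_Cons)
qed

lemma eval_formal_deriv_pure_poly:
  assumes "x \<in> carrier R"
  shows "eval (formal_deriv R (\<one> # replicate k \<zero> @ [c])) x = add_pow R (Suc k) \<one> \<otimes> x [^] k"
  using assms eval_formal_deriv_const[OF assms, of k c]
  by (simp add: formal_deriv_Cons length_formal_deriv)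

end


section \<open>Henselian valuation rings in ordered fields\<close>

locale henselian_ord_field = ord_field K r + valued_field K A for K (structure) and r A +
  assumes henselian: "henselian K A"
begin

lemma hensel_lift:
  assumes "p \<in> carrier (univ_poly K A)" "a \<in> A" "eval p a \<in> max_ideal K A"
    and "eval (formal_deriv K p) a \<in> val_units K A"
  shows "\<exists>b\<in>A. eval p b = \<zero>"
  using henselian assms unfolding henselian_def max_ideal_def by blast

text \<open>For negative \<open>b\<close>, the value of \<open>X\<^sup>2 + X + 1\<close> is \<open>(b + 1)\<^sup>2 - b\<close>; otherwise all terms are
  nonnegative.\<close>

lemma positive_third_cyclotomic:
  assumes b: "b \<in> carrier K"
  shows "positive (b \<otimes> b \<oplus> b \<oplus> \<one>)"
proof -
  consider "b = \<zero>" | "positive b" | "positive (\<ominus> b)" using positive_or_neg b by blast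
  then show ?thesis
  proof cases
    case 1 then show ?thesis using positive_one by simp
  next
    case 2 then show ?thesis by (intro positive_add positive_mult positive_one)
  next
    case 3
    have eq: "b \<otimes> b \<oplus> b \<oplus> \<one> = (b \<oplus> \<one>) \<otimes> (b \<oplus> \<one>) \<oplus> \<ominus> b"
      using b by algebra
    show ?thesis
    proof (cases "b \<oplus> \<one> = \<zero>")
      case True then show ?thesis using 3 b by (simp add: eq)
    next
      case False
      then have "positive ((b \<oplus> \<one>) \<otimes> (b \<oplus> \<one>))" using positive_square b by simp
      then show ?thesis unfolding eq using positive_add 3 by blast
    qed
  qed
qed

text \<open>
  This is where henselianity forces convexity, for any order. If \<open>m \<ge> 1\<close>, then \<open>X\<^sup>2 + X + m\<close> takes
  only positive values on \<open>K\<close>; but for \<open>m\<close> in the maximal ideal it has the residual zero \<open>0\<close>, which is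
  simple in every residue characteristic because the linear coefficient is \<open>1\<close>, and so it has a zero
  in \<open>A\<close>.
\<close>

lemma max_ideal_less_one:
  assumes m: "m \<in> max_ideal K A"
  shows "positive (\<one> \<ominus> m)"
proof (rule ccontr)
  assume neg: "\<not> positive (\<one> \<ominus> m)"
  have mA: "m \<in> A" and mc: "m \<in> carrier K" using m A_carrier by (auto simp: max_ideal_def)
  have "[\<one>, \<one>, m] \<in> carrier (univ_poly K A)"
    using A_one mA by (simp add: univ_poly_def polynomial_def)
  moreover have "eval [\<one>, \<one>, m] \<zero> \<in> max_ideal K A"
    using m mc by simp
  moreover have "eval (formal_deriv K [\<one>, \<one>, m]) \<zero> \<in> val_units K A"
    using A_one by (simp add: val_units_iff)
  ultimately obtain b where bA: "b \<in> A" and root: "eval [\<one>, \<one>, m] b = \<zero>"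
    using hensel_lift A_zero by blast
  have b: "b \<in> carrier K" using bA A_carrier by simp
  have root': "b \<otimes> b \<oplus> b \<oplus> m = \<zero>"
    using root b mc by (simp add: numeral_2_eq_2 a_assoc)
  have "b \<otimes> b \<oplus> b \<oplus> \<one> = (b \<otimes> b \<oplus> b \<oplus> m) \<oplus> (\<one> \<ominus> m)"
    using b mc by algebra
  then have "b \<otimes> b \<oplus> b \<oplus> \<one> = \<one> \<ominus> m" using root' mc by simp
  then show False using neg positive_third_cyclotomic[OF b] by simp
qed

text \<open>So the residue field has characteristic zero, and the derivative of \<open>X\<^sup>n - a\<close> does not vanish
  at residual zeros.\<close>

lemma nat_multiple_unit: "[Suc n] \<cdot> \<one> \<in> val_units K A"
proof (rule ccontr)
  assume "[Suc n] \<cdot> \<one> \<notin> val_units K A"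
  then have "[Suc n] \<cdot> \<one> \<in> max_ideal K A"
    using A_nat_multiple[of "Suc n"] unfolding max_ideal_def by blast
  then have "positive (\<one> \<ominus> [Suc n] \<cdot> \<one>)" by (rule max_ideal_less_one)
  moreover have "\<one> \<ominus> [Suc n] \<cdot> \<one> = \<ominus> ([n] \<cdot> \<one>)"
  proof -
    have c: "[n] \<cdot> \<one> \<in> carrier K" by simp
    have "\<one> \<ominus> ([n] \<cdot> \<one> \<oplus> \<one>) = \<ominus> ([n] \<cdot> \<one>)" using c by algebra
    then show ?thesis by (simp add: add.nat_pow_Suc)
  qed
  ultimately have *: "positive (\<ominus> ([n] \<cdot> \<one>))" by simp
  show False
  proof (cases n)
    case 0
    then show ?thesis using positive_nonzero[OF *] by simp
  next
    case (Suc k)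
    then show ?thesis using * positive_nat_multiple positive_asym by blast
  qed
qed

text \<open>Convexity in the form that makes the induced order on the residue field well defined: if the sum
  were infinitesimal, dividing it by \<open>a\<close> would give an element of the maximal ideal above \<open>1\<close>.\<close>

lemma positive_units_add:
  assumes a: "a \<in> val_units K A" "positive a" and u: "positive u"
  shows "a \<oplus> u \<notin> max_ideal K A"
proof
  assume m: "a \<oplus> u \<in> max_ideal K A"
  have c: "a \<in> carrier K" "a \<noteq> \<zero>" "u \<in> carrier K"
    using positive_carrier positive_nonzero a u by blast+
  note ia = nonzero_inv[OF c(1,2)]
  have "(a \<oplus> u) \<otimes> inv a \<in> max_ideal K A"
    using max_ideal_mult[OF m] a by (simp add: val_units_iff)
  then have "positive (\<one> \<ominus> (a \<oplus> u) \<otimes> inv a)" by (rule max_ideal_less_one)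
  moreover have "(a \<oplus> u) \<otimes> inv a = \<one> \<oplus> u \<otimes> inv a"
    using c ia by (simp add: l_distr)
  moreover have "\<one> \<ominus> (\<one> \<oplus> u \<otimes> inv a) = \<ominus> (u \<otimes> inv a)"
    using c ia(1) by algebra
  ultimately have "positive (\<ominus> (u \<otimes> inv a))" by simp
  then show False
    using positive_asym positive_mult[OF u positive_inv[OF a(2)]] by blast
qed

lemma residue_order_positive_iff:
  assumes u: "u \<in> val_units K A"
  shows "pos (residue_field K A) (residue_order K r A) (residue K A u) \<longleftrightarrow> positive u"
proof -
  let ?F = "residue_field K A"
  interpret h: ring_hom_ring "K\<lparr>carrier := A\<rparr>" ?F "residue K A" by (rule residue_hom)
  have uA: "u \<in> A" and uc: "u \<in> carrier K" using u A_carrier by (auto simp: val_units_iff)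
  have nz: "residue K A u \<noteq> \<zero>\<^bsub>?F\<^esub>" using residue_nonzero_iff[OF uA] u by simp
  have "pos ?F (residue_order K r A) (residue K A u) \<longleftrightarrow>
      (\<exists>a\<in>val_units K A. positive a \<and> residue K A u = residue K A a)"
    using nz residue_closed[OF uA] by (auto simp: pos_def residue_order_def a_minus_def)
  also have "\<dots> \<longleftrightarrow> positive u"
  proof
    assume "\<exists>a\<in>val_units K A. positive a \<and> residue K A u = residue K A a"
    then obtain a where a: "a \<in> val_units K A" "positive a" "residue K A a = residue K A u" by auto
    have "a \<in> A" using a by (simp add: val_units_iff)
    then have "a \<oplus> \<ominus> u \<in> max_ideal K A"
      using residue_eq_iff[of a u] uA a(3) by (simp add: a_minus_def)
    then have "\<not> positive (\<ominus> u)" using positive_units_add a by blast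
    then show "positive u" using positive_or_neg uc u by (auto simp: val_units_iff)
  qed (use u in blast)
  finally show ?thesis .
qed

text \<open>Residual roots of units lift, since \<open>X\<^sup>n - a\<close> is separable over the residue field.\<close>

lemma root_lift:
  assumes a: "a \<in> val_units K A" and c: "c \<in> A" and n: "0 < (n::nat)"
    and eq: "residue K A c [^]\<^bsub>residue_field K A\<^esub> n = residue K A a"
  shows "\<exists>b\<in>val_units K A. b [^] n = a"
proof -
  obtain k where k: "n = Suc k" using n gr0_conv_Suc by blast
  have aA: "a \<in> A" using a by (simp add: val_units_iff)
  note carr = A_carrier[OF c] A_carrier[OF aA]
  have res: "residue K A (c [^] n) = residue K A a" using eq residue_nat_pow[OF c] by simp
  then have "c [^] n \<in> val_units K A"
    using residue_nonzero_iff[OF aA] residue_nonzero_iff[OF A_nat_pow[OF c]] a by metis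
  then have cu: "c \<in> val_units K A" using unit_if_power_unit carr n by blast
  let ?p = "\<one> # replicate k \<zero> @ [\<ominus> a]"
  have "?p \<in> carrier (univ_poly K A)"
    using A_one A_zero A_neg[OF aA] by (auto simp: univ_poly_def polynomial_def)
  moreover have "eval ?p c \<in> max_ideal K A"
    unfolding eval_pure_poly[OF carr] k[symmetric]
    using residue_eq_iff[OF A_nat_pow[OF c] aA] res by blast
  moreover have "eval (formal_deriv K ?p) c \<in> val_units K A"
    unfolding eval_formal_deriv_pure_poly[OF carr(1)]
    by (intro units_mult nat_multiple_unit units_nat_pow cu)
  ultimately obtain b where b: "b \<in> A" "eval ?p b = \<zero>"
    using hensel_lift c by blast
  then have "b [^] n \<ominus> a = \<zero>" using eval_pure_poly A_carrier carr k by metis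
  then have "b [^] n = a" using b(1) A_carrier carr by simp
  then show ?thesis using unit_if_power_unit[OF A_carrier[OF b(1)] n] a by auto
qed

text \<open>
  A priori the order that witnesses real closedness of the residue field has no relation to \<open>r\<close>. Either the
  residue of \<open>u\<close> or that of \<open>\<ominus> u\<close> is a square there, so \<open>u\<close> or \<open>\<ominus> u\<close> is a square in \<open>K\<close>; the
  latter is impossible as \<open>u\<close> is positive.
\<close>

lemma positive_unit_sqrt:
  assumes rc: "real_closed (residue_field K A)"
    and u: "u \<in> val_units K A" "positive u"
  shows "\<exists>w\<in>val_units K A. positive w \<and> w [^] (2::nat) = u"
proof -
  let ?F = "residue_field K A"
  obtain s where s: "ordered_field ?F s"
    and sq: "\<And>x. pos ?F s x \<Longrightarrow> \<exists>y\<in>carrier ?F. x = y \<otimes>\<^bsub>?F\<^esub> y"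
    using rc by (auto simp: real_closed_def)
  interpret F: ord_field ?F s
    using s by (auto simp: ord_field_def ord_field_axioms_def ordered_field_def)
  have root: "\<exists>w\<in>val_units K A. w [^] (2::nat) = a"
    if a: "a \<in> val_units K A" and p: "pos ?F s (residue K A a)" for a
  proof -
    obtain y where y: "y \<in> carrier ?F" "residue K A a = y \<otimes>\<^bsub>?F\<^esub> y" using sq[OF p] by blast
    then have "y [^]\<^bsub>?F\<^esub> (2::nat) = residue K A a" by (simp add: numeral_2_eq_2)
    moreover obtain c where "c \<in> A" "y = residue K A c" using residue_surj[OF y(1)] by blast
    ultimately show ?thesis using root_lift[OF a] zero_less_numeral by blast
  qed
  have uA: "u \<in> A" using u by (simp add: val_units_iff)
  have "\<not> pos ?F s (residue K A (\<ominus> u))"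
  proof
    assume "pos ?F s (residue K A (\<ominus> u))"
    then obtain w where w: "w \<in> val_units K A" "w [^] (2::nat) = \<ominus> u"
      using root units_uminus[OF u(1)] by blast
    then have "w \<in> carrier K" "w \<noteq> \<zero>" using A_carrier by (auto simp: val_units_iff)
    then have "positive (w [^] (2::nat))" using positive_square by (simp add: numeral_2_eq_2)
    then show False using w positive_asym[OF u(2)] by simp
  qed
  then have "pos ?F s (residue K A u)"
    using F.positive_or_neg[OF residue_closed[OF uA]] residue_nonzero_iff[OF uA] u(1)
      residue_uminus[OF uA] by auto
  then obtain w where w: "w \<in> val_units K A" "w [^] (2::nat) = u" using root u by blast
  then have wc: "w \<in> carrier K" "w \<noteq> \<zero>" using A_carrier by (auto simp: val_units_iff)
  have "(\<ominus> w) [^] (2::nat) = w [^] (2::nat)"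
    using wc by (simp add: numeral_2_eq_2 l_minus r_minus)
  then have "(\<ominus> w) [^] (2::nat) = u" using w(2) by simp
  then show ?thesis using positive_or_neg[OF wc] w units_uminus by blast
qed

lemma positive_unit_odd_root:
  assumes rc: "real_closed (residue_field K A)"
    and u: "u \<in> val_units K A" "positive u" and n: "odd (n::nat)"
  shows "\<exists>w\<in>val_units K A. positive w \<and> w [^] n = u"
proof -
  let ?F = "residue_field K A"
  have F: "field ?F" using rc by (auto simp: real_closed_def ordered_field_def)
  interpret F: field ?F by (rule F)
  obtain k where k: "n = Suc k" using n by (cases n) auto
  have uA: "u \<in> A" using u by (simp add: val_units_iff)
  note ru = residue_closed[OF uA]
  let ?p = "\<one>\<^bsub>?F\<^esub> # replicate k \<zero>\<^bsub>?F\<^esub> @ [\<ominus>\<^bsub>?F\<^esub> residue K A u]"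
  have "?p \<in> carrier (univ_poly ?F (carrier ?F))"
    using ru by (auto simp: univ_poly_def polynomial_def)
  moreover have "odd (degree ?p)" using n k by simp
  ultimately obtain x where x: "x \<in> carrier ?F" "ring.eval ?F ?p x = \<zero>\<^bsub>?F\<^esub>"
    using rc unfolding real_closed_def by blast
  then have "x [^]\<^bsub>?F\<^esub> n \<ominus>\<^bsub>?F\<^esub> residue K A u = \<zero>\<^bsub>?F\<^esub>"
    using F.eval_pure_poly[OF x(1) ru] k by simp
  then have "x [^]\<^bsub>?F\<^esub> n = residue K A u" using x(1) ru by simp
  moreover obtain c where "c \<in> A" "x = residue K A c" using residue_surj[OF x(1)] by blast
  ultimately obtain w where w: "w \<in> val_units K A" "w [^] n = u"
    using root_lift[OF u(1)] k by blast
  then have "positive w" using positive_odd_root[of w n] n u A_carrier by (auto simp: val_units_iff)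
  then show ?thesis using w by blast
qed

text \<open>The positive units form a divisible group: peel off square roots until the exponent is odd.\<close>

lemma positive_unit_root:
  assumes rc: "real_closed (residue_field K A)" and "u \<in> val_units K A" "positive u" "0 < n"
  shows "\<exists>w\<in>val_units K A. positive w \<and> w [^] (n::nat) = u"
  using assms(2-)
proof (induction n arbitrary: u rule: less_induct)
  case (less n)
  show ?case
  proof (cases "odd n")
    case True
    then show ?thesis using positive_unit_odd_root[OF rc] less.prems by blast
  next
    case False
    then obtain m where m: "n = m * 2" by (metis dvdE mult.commute)
    obtain v where v: "v \<in> val_units K A" "positive v" "v [^] (2::nat) = u"
      using positive_unit_sqrt[OF rc] less.prems by blast
    obtain w where w: "w \<in> val_units K A" "positive w" "w [^] m = v"
      using less.IH[of m v] v m less.prems by auto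
    have "w [^] n = u" using v(3) w positive_carrier by (simp add: m nat_pow_pow[symmetric])
    then show ?thesis using w by blast
  qed
qed


section \<open>Compatible angular components\<close>

lemma positive_units_subgroup: "subgroup {u \<in> val_units K A. positive u} (mult_of K)"
proof -
  interpret G: comm_group "mult_of K" by (rule mult_of_comm_group)
  have inv_eq: "inv\<^bsub>mult_of K\<^esub> u = inv u" if "positive u" for u
    using that positive_carrier positive_nonzero
    by (simp add: mult_of_eq_units_of units_of_inv field_Units)
  show ?thesis
  proof (rule G.subgroupI)
    show "{u \<in> val_units K A. positive u} \<subseteq> carrier (mult_of K)"
      using subgroup.subset[OF units_subgroup] by auto
    show "{u \<in> val_units K A. positive u} \<noteq> {}"
      using positive_one subgroup.one_closed[OF units_subgroup] by auto
    show "inv\<^bsub>mult_of K\<^esub> u \<in> {u \<in> val_units K A. positive u}"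
      if "u \<in> {u \<in> val_units K A. positive u}" for u
      using that subgroup.m_inv_closed[OF units_subgroup, of u] inv_eq[of u] positive_inv[of u]
      by auto
    show "u \<otimes>\<^bsub>mult_of K\<^esub> w \<in> {u \<in> val_units K A. positive u}"
      if "u \<in> {u \<in> val_units K A. positive u}" "w \<in> {u \<in> val_units K A. positive u}" for u w
      using that units_mult positive_mult by simp
  qed
qed

text \<open>The sign is put back by hand: \<open>\<tau>\<close> is the product of \<open>\<rho>\<close> with the sign character, a homomorphism
  to the units of \<open>A\<close> that preserves signs and fixes every unit.\<close>

lemma angular_component_if_retract:
  assumes \<rho>: "\<rho> \<in> hom (mult_of K) (mult_of K)"
    and range: "\<And>x. x \<in> carrier (mult_of K) \<Longrightarrow> \<rho> x \<in> val_units K A \<and> positive (\<rho> x)"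
    and id: "\<And>u. u \<in> val_units K A \<Longrightarrow> positive u \<Longrightarrow> \<rho> u = u"
  shows "\<exists>ac. angular_component K A ac \<and> compatible K r A ac"
proof -
  let ?F = "residue_field K A"
  interpret h: ring_hom_ring "K\<lparr>carrier := A\<rparr>" ?F "residue K A" by (rule residue_hom)
  have \<rho>c: "\<rho> x \<in> carrier K" if "x \<in> carrier K" "x \<noteq> \<zero>" for x
    using range that positive_carrier by simp
  have \<rho>_mult: "\<rho> (x \<otimes> y) = \<rho> x \<otimes> \<rho> y"
    if "x \<in> carrier K" "x \<noteq> \<zero>" "y \<in> carrier K" "y \<noteq> \<zero>" for x y
    using hom_mult[OF \<rho>] that by simp
  have minus_one: "\<ominus> \<one> \<in> carrier K" "\<ominus> \<one> \<noteq> \<zero>"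
    by (auto simp: add.inv_eq_1_iff)
  \<comment> \<open>As \<open>\<rho> (\<ominus> \<one>)\<close> is a positive square root of \<open>\<one>\<close>, the retraction forgets signs.\<close>
  have "\<rho> (\<ominus> \<one>) \<otimes> \<rho> (\<ominus> \<one>) = \<rho> \<one>"
    using \<rho>_mult[OF minus_one minus_one] by (simp add: l_minus)
  also have "\<rho> \<one> = \<one>" using id[of \<one>] positive_one A_one by (simp add: val_units_iff)
  finally have "\<rho> (\<ominus> \<one>) = \<one> \<or> \<rho> (\<ominus> \<one>) = \<ominus> \<one>"
    using square_eq_one \<rho>c minus_one by simp
  moreover have "\<rho> (\<ominus> \<one>) \<noteq> \<ominus> \<one>"
    using range[of "\<ominus> \<one>"] minus_one positive_asym[OF positive_one] by auto
  ultimately have \<rho>1: "\<rho> (\<ominus> \<one>) = \<one>" by blast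
  have \<rho>_neg: "\<rho> (\<ominus> x) = \<rho> x" if "x \<in> carrier K" "x \<noteq> \<zero>" for x
    using \<rho>_mult[OF minus_one that] \<rho>1 that \<rho>c by (simp add: l_minus)
  define \<tau> where "\<tau> x = (if positive x then \<rho> x else \<ominus> \<rho> x)" for x
  define ac where "ac x = (if x = \<zero> then \<zero>\<^bsub>?F\<^esub> else residue K A (\<tau> x))" for x
  have \<tau>u: "\<tau> x \<in> val_units K A" if "x \<in> carrier K" "x \<noteq> \<zero>" for x
    using range[of x] that units_uminus by (simp add: \<tau>_def)
  then have \<tau>A: "\<tau> x \<in> A" if "x \<in> carrier K" "x \<noteq> \<zero>" for x
    using that by (simp add: val_units_iff)
  have \<tau>_mult: "\<tau> (x \<otimes> y) = \<tau> x \<otimes> \<tau> y"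
    if x: "x \<in> carrier K" "x \<noteq> \<zero>" and y: "y \<in> carrier K" "y \<noteq> \<zero>" for x y
  proof -
    note c = x y \<rho>c[OF x] \<rho>c[OF y]
    have neg: "\<not> positive (x \<otimes> y)" if "positive x" "positive (\<ominus> y)"
      using positive_mult_left_iff[OF that(1) y(1)] positive_asym[OF that(2)] y by simp
    have neg': "\<not> positive (x \<otimes> y)" if "positive (\<ominus> x)" "positive y"
      using positive_mult_left_iff[OF that(2) x(1)] positive_asym[OF that(1)] x y
      by (simp add: m_comm)
    have both: "positive (x \<otimes> y)" if "positive (\<ominus> x)" "positive (\<ominus> y)"
      using positive_mult[OF that] x y by (simp add: l_minus r_minus)
    consider "positive x" "positive y" | "positive x" "\<not> positive y" "positive (\<ominus> y)"
      | "\<not> positive x" "positive (\<ominus> x)" "positive y"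
      | "\<not> positive x" "positive (\<ominus> x)" "\<not> positive y" "positive (\<ominus> y)"
      using positive_or_neg[OF x] positive_or_neg[OF y] by blast
    then show ?thesis
    proof cases
      case 1 then show ?thesis using positive_mult \<rho>_mult[OF x y] by (simp add: \<tau>_def)
    next
      case 2 then show ?thesis using neg \<rho>_mult[OF x y] c by (simp add: \<tau>_def r_minus)
    next
      case 3 then show ?thesis using neg' \<rho>_mult[OF x y] c by (simp add: \<tau>_def l_minus)
    next
      case 4 then show ?thesis using both \<rho>_mult[OF x y] c by (simp add: \<tau>_def l_minus r_minus)
    qed
  qed
  have \<tau>_id: "\<tau> u = u" if u: "u \<in> val_units K A" for u
  proof (cases "positive u")
    case True then show ?thesis using id[OF u] by (simp add: \<tau>_def)
  next
    case False
    have uc: "u \<in> carrier K" "u \<noteq> \<zero>" using u A_carrier by (auto simp: val_units_iff)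
    then have "positive (\<ominus> u)" using False positive_or_neg by blast
    then have "\<rho> (\<ominus> u) = \<ominus> u" using id units_uminus u by blast
    then show ?thesis using False \<rho>_neg[OF uc] uc by (simp add: \<tau>_def)
  qed
  have \<tau>_pos: "positive (\<tau> x) \<longleftrightarrow> positive x" if "x \<in> carrier K" "x \<noteq> \<zero>" for x
    using range[of x] that positive_asym[of "\<rho> x"] by (auto simp: \<tau>_def)
  have ac_closed: "ac x \<in> carrier ?F" if "x \<in> carrier K" for x
    using residue_closed \<tau>A that by (simp add: ac_def)
  have "angular_component K A ac"
    unfolding angular_component_def
  proof (intro conjI ballI)
    show "ac \<in> carrier K \<rightarrow> carrier ?F" using ac_closed by blast
    show "ac \<zero> = \<zero>\<^bsub>?F\<^esub>" by (simp add: ac_def)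
    show "ac \<in> hom (mult_of K) (mult_of ?F)"
    proof (rule homI)
      show "ac x \<in> carrier (mult_of ?F)" if "x \<in> carrier (mult_of K)" for x
        using that ac_closed \<tau>A \<tau>u residue_nonzero_iff[of "\<tau> x"] by (simp add: ac_def)
      show "ac (x \<otimes>\<^bsub>mult_of K\<^esub> y) = ac x \<otimes>\<^bsub>mult_of ?F\<^esub> ac y"
        if "x \<in> carrier (mult_of K)" "y \<in> carrier (mult_of K)" for x y
        using that \<tau>_mult \<tau>A residue_mult by (simp add: ac_def integral_iff)
    qed
    show "ac u = residue K A u" if "u \<in> val_units K A" for u
      using that \<tau>_id by (simp add: ac_def val_units_iff)
  qed
  moreover have "compatible K r A ac"
    unfolding compatible_def
  proof
    fix x assume x: "x \<in> carrier K"
    show "positive x \<longleftrightarrow> pos ?F (residue_order K r A) (ac x)"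
    proof (cases "x = \<zero>")
      case True
      then show ?thesis by (simp add: ac_def pos_def)
    next
      case False
      then show ?thesis using residue_order_positive_iff \<tau>u \<tau>_pos x by (simp add: ac_def)
    qed
  qed
  ultimately show ?thesis by blast
qed

end

theorem proposition3p2:
  fixes K :: "('a, 'b) ring_scheme" and r :: "'a rel" and A :: "'a set"
  assumes "almost_real_closed K"
    and "ordered_field K r"
    and "canonical_henselian K A"
  shows "\<exists>ac. angular_component K A ac \<and> compatible K r A ac"
proof -
  obtain B where B: "henselian K B" "real_closed (residue_field K B)"
    using assms(1) by (auto simp: almost_real_closed_def)
  have A: "henselian K A" "A \<subseteq> B"
    using assms(3) B(1) by (auto simp: canonical_henselian_def)
  have loc: "henselian_ord_field K r C" if "henselian K C" for C
    using that assms(2)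
    by (simp add: henselian_ord_field_def henselian_ord_field_axioms_def ord_field_def
        ord_field_axioms_def valued_field_def valued_field_axioms_def ordered_field_def henselian_def)
  interpret A: henselian_ord_field K r A by (rule loc[OF A(1)])
  interpret B: henselian_ord_field K r B by (rule loc[OF B(1)])
  interpret G: comm_group "mult_of K" by (rule A.mult_of_comm_group)
  define U where "U = {u \<in> val_units K A. A.positive u}"
  have U: "subgroup U (mult_of K)"
    unfolding U_def by (rule A.positive_units_subgroup)
  \<comment> \<open>Roots are taken in \<open>B\<close>, whose residue field is real closed; they stay units of the finer \<open>A\<close>.\<close>
  have div: "\<exists>w\<in>U. w [^]\<^bsub>mult_of K\<^esub> n = u" if u: "u \<in> U" and n: "0 < n" for u and n :: nat
  proof -
    have "u \<in> val_units K B" "A.positive u"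
      using u A(2) by (auto simp: U_def A.val_units_iff B.val_units_iff)
    then obtain w where w: "A.positive w" "w [^]\<^bsub>K\<^esub> n = u"
      using B.positive_unit_root[OF B(2) _ _ n] by blast
    then have "w \<in> val_units K A"
      using A.unit_if_power_unit[OF A.positive_carrier n] u by (simp add: U_def)
    then show ?thesis using w by (auto simp: U_def Ring_Divisibility.nat_pow_mult_of)
  qed
  obtain \<rho> where \<rho>: "\<rho> \<in> hom (mult_of K) (mult_of K\<lparr>carrier := U\<rparr>)" "\<forall>u\<in>U. \<rho> u = u"
    using G.divisible_subgroup_retract[OF U div] by blast
  have range: "\<rho> x \<in> U" if "x \<in> carrier (mult_of K)" for x
    using hom_in_carrier[OF \<rho>(1) that] by simp
  have "\<rho> \<in> hom (mult_of K) (mult_of K)"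
    using \<rho>(1) subgroup.subset[OF U] by (auto simp: hom_def)
  then show ?thesis
    using A.angular_component_if_retract range \<rho>(2) by (auto simp: U_def)
qed

end
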